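(* Let $\mu$ be a probability measure on $\mathbb{R}$, let $\mu_{\min}$ and $\mu_{\max}$ be the infimum and supremum of its support, and let $g(x)=-\log\mu((x,\infty))$ for $x\in[\mu_{\min},\mu_{\max}]$. If $g$ is thrice differentiable with $g''\ge 0$ and $g'''\le 0$ on $(\mu_{\min},\mu_{\max})$, then the function $$\rho_{\mu,1}(m)=\frac{\mu((m,\infty))^2}{(\mu*\mu)([2m,\infty))}$$ is strictly monotone decreasing on $[\mu_{\min},\mu_{\max})$.
   Context: $\mu_{\min}$ and $\mu_{\max}$ may be infinite, in which case the intervals are read with the corresponding endpoint excluded. $\mu*\mu$ is the convolution of $\mu$ with itself, i.e. the law of the sum of two independent $\mu$-distributed variables. The function $\rho_{\mu,1}(m)$ is defined for $m<\mu_{\max}$.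
   Formalization: It is additionally assumed that μ has no atom at a finite μ_min or μ_max; with such an atom the claim fails (e.g. ½δ_0+½Exp(1), where ρ(0)=1/4<ρ(0+)=1/3), except for point masses, where the interval is empty. *)

theory Defs
  imports "HOL-Probability.Probability"
begin

definition measure_support :: "real measure \<Rightarrow> real set" where
  "measure_support M = {x. \<forall>U. open U \<longrightarrow> x \<in> U \<longrightarrow> measure M U > 0}"

definition mu_min :: "real measure \<Rightarrow> ereal" where
  "mu_min M = (INF x\<in>measure_support M. ereal x)"

definition mu_max :: "real measure \<Rightarrow> ereal" where
  "mu_max M = (SUP x\<in>measure_support M. ereal x)"

(* The intended value at x = mu_max is infinity, whereas ln 0 = 0 gives 0 here; this function
   is only ever considered for x < mu_max, where the tail is positive. *)
definition neg_log_tail :: "real measure \<Rightarrow> real \<Rightarrow> real" where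
  "neg_log_tail M x = - ln (measure M {x<..})"

definition thrice_differentiable_on :: "(real \<Rightarrow> real) \<Rightarrow> real set \<Rightarrow> bool" where
  "thrice_differentiable_on f S \<longleftrightarrow> (\<forall>k<3. \<forall>x\<in>S. (deriv ^^ k) f differentiable (at x))"

definition rho1 :: "real measure \<Rightarrow> real \<Rightarrow> real" where
  "rho1 M m = (measure M {m<..})\<^sup>2 / measure (M \<star> M) {2 * m..}"

(* These two intervals are sets of reals, so an infinite endpoint is excluded automatically. *)
definition open_range :: "real measure \<Rightarrow> real set" where
  "open_range M = {x. mu_min M < ereal x \<and> ereal x < mu_max M}"

definition right_open_range :: "real measure \<Rightarrow> real set" where
  "right_open_range M = {x. mu_min M \<le> ereal x \<and> ereal x < mu_max M}"

(* A finite endpoint of the support carries no mass, so that the tail x \<mapsto> \<mu>((x,\<infinity>)) equals 1 at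
   a finite mu_min and tends to 0 at a finite mu_max.  Derivatives of neg_log_tail in the
   interior do not imply this, and if mu_min < mu_max then rho1 is never strictly decreasing
   without it (it jumps up at an atom mu_min and tends to its upper bound 1 at an atom mu_max), for
   example for 1/2 \<delta>_0 + 1/2 Exp(1) and for the law of min(X,1) with X exponential. *)
definition no_endpoint_atoms :: "real measure \<Rightarrow> bool" where
  "no_endpoint_atoms M \<longleftrightarrow>
     (\<forall>x. ereal x = mu_min M \<or> ereal x = mu_max M \<longrightarrow> measure M {x} = 0)"

end

theory Submission
  imports Defs
begin

text \<open>
  Write \<open>S x\<close> for the tail \<open>\<mu>((x,\<infinity>))\<close>, so that \<open>S = exp (- g)\<close> below \<open>mu_max\<close>. Without atoms, the
  event \<open>X + Y \<ge> 2m\<close> for two independent copies splits, up to a null set, into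
  \<open>X, Y > m\<close> and two parts that mirror each other, in which one variable is at most \<open>m\<close> and the
  other one makes up for it (lemma \<open>emeasure_convolution_tail\<close>). The first part has
  probability \<open>(S m)\<^sup>2\<close>. If the support starts at a finite point \<open>a\<close>, then \<open>\<mu>\<close> has the density
  \<open>g' S\<close> on \<open>(a,\<infinity>)\<close> (lemma \<open>density_from_tail_derivative\<close>), and with the smaller variable
  written as \<open>m - t\<close> the reciprocal of \<open>rho1\<close> becomes
  \<open>1 + 2 \<integral>\<^sub>0\<^sup>m\<^sup>-\<^sup>a exp (- (g(m + t) + g(m - t) - 2 g(m))) g'(m - t) dt\<close>.
  Everything on the right grows with \<open>m\<close>: the range of integration does, \<open>g'(m - t)\<close> does because
  \<open>g\<close> is convex, and the second difference in the exponent shrinks because \<open>g'\<close> is concave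
  (lemma \<open>second_difference_antimono\<close>). The growth is strict because \<open>g' > 0\<close>, so that the
  newly added piece of the range contributes a positive amount. No integral has to be
  differentiated in \<open>m\<close>.

  The hypotheses force the support to be of the form just used. A finite \<open>mu_max\<close> without an atom
  would need \<open>g\<close> to blow up there, but a bounded second derivative keeps \<open>g\<close> bounded on bounded
  intervals (lemma \<open>quadratic_upper_bound\<close>). If \<open>mu_min\<close> were infinite, then \<open>g\<close> would be
  a nonnegative nondecreasing function on the whole line, and the sign conditions leave only
  constants (lemma \<open>constant_if_nonneg_on_whole_line\<close>), whereas the tail of a probability measure
  is not constant. A zero of \<open>g'\<close> is excluded in the same manner (lemma
  \<open>constant_if_slope_vanishes\<close>).
\<close>

section \<open>Convex functions with concave slope\<close>

text \<open>
  The condition \<open>g''' \<le> 0\<close> enters only through the monotonicity of \<open>g2\<close>, the second derivative.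
\<close>

locale convex_with_concave_slope =
  fixes I :: "real set" and g g1 g2 :: "real \<Rightarrow> real"
  assumes open_I: "open I"
    and interval_I: "is_interval I"
    and g_deriv: "x \<in> I \<Longrightarrow> (g has_real_derivative g1 x) (at x)"
    and g1_deriv: "x \<in> I \<Longrightarrow> (g1 has_real_derivative g2 x) (at x)"
    and g2_nonneg: "x \<in> I \<Longrightarrow> 0 \<le> g2 x"
    and g2_antimono: "x \<in> I \<Longrightarrow> y \<in> I \<Longrightarrow> x \<le> y \<Longrightarrow> g2 y \<le> g2 x"
begin

lemma between_in_I: "x \<in> I \<Longrightarrow> y \<in> I \<Longrightarrow> x \<le> z \<Longrightarrow> z \<le> y \<Longrightarrow> z \<in> I"
  using mem_is_interval_1_I[OF interval_I] .

lemma g_MVT: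
  assumes "x \<in> I" "y \<in> I" "x < y"
  obtains z where "x < z" "z < y" "z \<in> I" "g y - g x = (y - x) * g1 z"
proof -
  have "\<exists>z. x < z \<and> z < y \<and> g y - g x = (y - x) * g1 z"
    by (rule MVT2[OF assms(3)]) (rule g_deriv[OF between_in_I[OF assms(1,2)]])
  then show ?thesis using that between_in_I[OF assms(1,2)] by force
qed

lemma slope_MVT:
  assumes "x \<in> I" "y \<in> I" "x < y"
  obtains z where "x < z" "z < y" "z \<in> I" "g1 y - g1 x = (y - x) * g2 z"
proof -
  have "\<exists>z. x < z \<and> z < y \<and> g1 y - g1 x = (y - x) * g2 z"
    by (rule MVT2[OF assms(3)]) (rule g1_deriv[OF between_in_I[OF assms(1,2)]])
  then show ?thesis using that between_in_I[OF assms(1,2)] by force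
qed

lemma slope_mono:
  assumes "x \<in> I" "y \<in> I" "x \<le> y"
  shows "g1 x \<le> g1 y"
proof (rule DERIV_nonneg_imp_nondecreasing[OF assms(3)])
  fix z assume "x \<le> z" "z \<le> y"
  then have "z \<in> I" by (rule between_in_I[OF assms(1,2)])
  then show "\<exists>d. (g1 has_real_derivative d) (at z) \<and> 0 \<le> d"
    using g1_deriv g2_nonneg by blast
qed

lemma slope_symmetric_le:
  assumes "m - t \<in> I" "m + t \<in> I" "0 \<le> t"
  shows "g1 (m + t) + g1 (m - t) \<le> 2 * g1 m"
proof (cases "t = 0")
  case False
  with assms have t: "0 < t" by simp
  have m: "m \<in> I" using between_in_I[OF assms(1,2)] t by simp
  obtain u where u: "m - t < u" "u < m" "u \<in> I" "g1 m - g1 (m - t) = t * g2 u"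
    using slope_MVT[of "m - t" m] assms m t by auto
  obtain v where v: "m < v" "v < m + t" "v \<in> I" "g1 (m + t) - g1 m = t * g2 v"
    using slope_MVT[of m "m + t"] assms m t by auto
  have "t * g2 v \<le> t * g2 u"
    using t u v g2_antimono[of u v] by simp
  then show ?thesis using u v by linarith
qed simp

text \<open>
  The derivative of the second difference in its centre is again a second difference, that of the
  slope, which is nonpositive by concavity.
\<close>

lemma second_difference_antimono:
  assumes "m - t \<in> I" "n + t \<in> I" "0 \<le> t" "m \<le> n"
  shows "g (n + t) + g (n - t) - 2 * g n \<le> g (m + t) + g (m - t) - 2 * g m"
proof (rule DERIV_nonpos_imp_nonincreasing[OF \<open>m \<le> n\<close>])
  fix x assume x: "m \<le> x" "x \<le> n"
  have xI: "x + t \<in> I" "x - t \<in> I" "x \<in> I"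
    using x assms by (auto intro: between_in_I[OF assms(1,2)])
  have "((\<lambda>x. g (x + t)) has_real_derivative g1 (x + t)) (at x)"
    "((\<lambda>x. g (x - t)) has_real_derivative g1 (x - t)) (at x)"
    using g_deriv[OF xI(1)] g_deriv[OF xI(2)] DERIV_shift[of g _ x t] DERIV_shift[of g _ x "- t"]
    by simp_all
  then have "((\<lambda>x. g (x + t) + g (x - t) - 2 * g x) has_real_derivative
           g1 (x + t) + g1 (x - t) - 2 * g1 x) (at x)"
    by (intro DERIV_diff DERIV_add DERIV_cmult g_deriv[OF xI(3)])
  moreover have "g1 (x + t) + g1 (x - t) - 2 * g1 x \<le> 0"
    using slope_symmetric_le[of x t] xI assms by simp
  ultimately show "\<exists>y. ((\<lambda>x. g (x + t) + g (x - t) - 2 * g x) has_real_derivative y) (at x) \<and> y \<le> 0"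
    by blast
qed

text \<open>
  This is the second-order Taylor bound, up to a factor of 2 in the quadratic term: to the right of
  \<open>c\<close> the second derivative is at most its value at \<open>c\<close>. What matters is that the bound stays finite
  as \<open>x\<close> approaches a finite right end of \<open>I\<close>.
\<close>

lemma quadratic_upper_bound:
  assumes "c \<in> I" "x \<in> I" "c \<le> x"
  shows "g x \<le> g c + (x - c) * (g1 c + (x - c) * g2 c)"
proof (cases "c = x")
  case False
  with assms have cx: "c < x" by simp
  obtain z where z: "c < z" "z < x" "g x - g c = (x - c) * g1 z"
    using g_MVT[OF assms(1,2) cx] by metis
  obtain w where w: "c < w" "w \<in> I" "g1 x - g1 c = (x - c) * g2 w"
    using slope_MVT[OF assms(1,2) cx] by metis
  have "g1 z \<le> g1 x"
    using z between_in_I[OF assms(1,2), of z] assms by (intro slope_mono) auto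
  also have "g1 x \<le> g1 c + (x - c) * g2 c"
  proof -
    have "(x - c) * g2 w \<le> (x - c) * g2 c"
      using w g2_antimono[of c w] assms cx by (intro mult_left_mono) auto
    then show ?thesis using w by linarith
  qed
  finally have "(x - c) * g1 z \<le> (x - c) * (g1 c + (x - c) * g2 c)"
    using cx by (intro mult_left_mono) auto
  then show ?thesis using z by linarith
qed simp

text \<open>
  A zero \<open>c\<close> of a nonnegative slope spreads in both directions. To the left, the slope is
  squeezed between 0 and its value at \<open>c\<close>. To the right, it cannot grow: \<open>c\<close> is a minimum of the
  slope, so \<open>g2\<close> vanishes at \<open>c\<close> and hence is nonpositive from there on.
\<close>

lemma constant_if_slope_vanishes:
  assumes nonneg: "\<And>x. x \<in> I \<Longrightarrow> 0 \<le> g1 x"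
    and c: "c \<in> I" "g1 c = 0" and xy: "x \<in> I" "y \<in> I"
  shows "g x = g y"
proof -
  obtain d where d: "0 < d" "ball c d \<subseteq> I"
    using open_I c by (auto simp: open_contains_ball)
  have "g2 c = 0"
    using d nonneg c
    by (intro DERIV_local_min[OF g1_deriv[OF c(1)] d(1)]) (auto simp: ball_def dist_real_def)
  then have g2_le: "g2 z \<le> 0" if "z \<in> I" "c \<le> z" for z
    using g2_antimono[of c z] that c by simp
  have g1_zero: "g1 z = 0" if z: "z \<in> I" for z
  proof (cases "z \<le> c")
    case True
    then show ?thesis using slope_mono[of z c] nonneg[OF z] z c by simp
  next
    case False
    then have "c < z" by simp
    then obtain w where "c < w" "w \<in> I" "g1 z - g1 c = (z - c) * g2 w"
      using slope_MVT[OF c(1) z] by metis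
    then have "g1 z \<le> 0"
      using g2_le[of w] c \<open>c < z\<close> mult_nonneg_nonpos[of "z - c" "g2 w"] by simp
    then show ?thesis using nonneg[OF z] by simp
  qed
  have eq: "g u = g v" if uv: "u \<in> I" "v \<in> I" "u < v" for u v
  proof -
    obtain z where "u < z" "z < v" "g v - g u = (v - u) * g1 z"
      using g_MVT[OF uv] by metis
    then show ?thesis using g1_zero between_in_I[OF uv(1,2), of z] by simp
  qed
  show ?thesis
    using eq[OF xy] eq[OF xy(2,1), symmetric] by (cases x y rule: linorder_cases) blast+
qed

text \<open>
  Two descents to \<open>-\<infinity>\<close>. If \<open>g2 c > 0\<close>, then \<open>g2\<close> is at least \<open>g2 c\<close> to the left of \<open>c\<close>, which makes
  the slope negative far to the left; so \<open>g2 = 0\<close> and the slope is constant. If that constant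
  were positive, \<open>g\<close> itself would be negative far to the left.
\<close>

lemma constant_if_nonneg_on_whole_line:
  assumes UNIV: "I = UNIV" and nonneg: "\<And>x. 0 \<le> g1 x" "\<And>x. 0 \<le> g x"
  shows "g x = g y"
proof (cases "g1 0 = 0")
  case True
  then show ?thesis using constant_if_slope_vanishes[of 0] UNIV nonneg by simp
next
  case False
  then have pos: "0 < g1 0" using nonneg(1)[of 0] by simp
  have g2_zero: "g2 c = 0" for c
  proof (rule ccontr)
    assume "g2 c \<noteq> 0"
    then have g2c: "0 < g2 c" using g2_nonneg[of c] UNIV by simp
    \<comment> \<open>The line through \<open>(c, g1 c)\<close> with slope \<open>g2 c\<close> takes the value \<open>-1\<close> at this point.\<close>
    define z where "z = c - (g1 c + 1) / g2 c"
    have zc: "z < c" using g2c nonneg(1)[of c] by (simp add: z_def add_nonneg_pos)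
    obtain w where w: "z < w" "w < c" "g1 c - g1 z = (c - z) * g2 w"
      using slope_MVT[of z c] UNIV zc by auto
    have "(c - z) * g2 c \<le> (c - z) * g2 w"
      using zc w g2_antimono[of w c] UNIV by (intro mult_left_mono) auto
    moreover have "(c - z) * g2 c = g1 c + 1" using g2c by (simp add: z_def)
    ultimately show False using w nonneg(1)[of z] by linarith
  qed
  have g1_le: "g1 0 \<le> g1 z" if z: "z < 0" for z
  proof -
    obtain w where "g1 0 - g1 z = (0 - z) * g2 w"
      using slope_MVT[of z 0] UNIV z by (metis UNIV_I)
    then show ?thesis using g2_zero[of w] by simp
  qed
  \<comment> \<open>The line through \<open>(0, g 0)\<close> with slope \<open>g1 0\<close> takes the value \<open>-1\<close> at this point.\<close>
  define z where "z = - (g 0 + 1) / g1 0"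
  have z: "z < 0" using pos nonneg(2)[of 0] by (simp add: z_def divide_neg_pos)
  obtain w where w: "z < w" "w < 0" "g 0 - g z = (0 - z) * g1 w"
    using g_MVT[of z 0] z UNIV by (metis UNIV_I)
  have "(0 - z) * g1 0 \<le> (0 - z) * g1 w"
    using z w g1_le[of w] by (intro mult_left_mono) auto
  moreover have "(0 - z) * g1 0 = g 0 + 1" using pos by (simp add: z_def)
  ultimately show ?thesis using w nonneg(2)[of z] by linarith
qed

end

section \<open>Supports and tails\<close>

text \<open>
  The complement of the support is a union of open null sets. Since the
  line is second countable, countably many of them suffice.
\<close>

lemma (in real_distribution) measure_eq_0_outside_support:
  assumes "U \<inter> measure_support M = {}" "U \<in> sets M"
  shows "measure M U = 0"
proof -
  define F where "F = {V. open V \<and> measure M V = 0}"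
  obtain F' where F': "F' \<subseteq> F" "countable F'" "\<Union>F' = \<Union>F"
    using Lindelof[of F] by (auto simp: F_def)
  have "\<Union>F' \<in> null_sets M"
    using F' by (intro null_sets_UN'[of F' "\<lambda>x. x", simplified])
      (auto simp: F_def null_sets_def emeasure_eq_measure)
  moreover have "U \<subseteq> \<Union>F'"
    using assms(1) F'(3) zero_less_measure_iff
    by (force simp: measure_support_def F_def)
  ultimately have "U \<in> null_sets M"
    using assms(2) null_sets_subset by blast
  then show ?thesis by (simp add: measure_eq_0_null_sets)
qed

context real_distribution
begin

lemma tail_eq_cdf: "measure M {x<..} = 1 - cdf M x"
proof -
  have "measure M {x<..} = measure M (space M - {..x})"
    by (rule arg_cong[where f="measure M"]) (auto simp: borel_UNIV)
  also have "\<dots> = 1 - cdf M x"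
    unfolding cdf_def by (rule prob_compl) simp
  finally show ?thesis .
qed

lemma tail_pos:
  assumes "ereal x < mu_max M"
  shows "0 < measure M {x<..}"
proof -
  obtain s where "s \<in> measure_support M" "x < s"
    using assms by (auto simp: mu_max_def less_SUP_iff)
  then show ?thesis by (auto simp: measure_support_def)
qed

lemma tail_at_finite_mu_max:
  assumes "mu_max M = ereal b"
  shows "measure M {b<..} = 0"
proof (rule measure_eq_0_outside_support)
  have "s \<le> b" if "s \<in> measure_support M" for s
    using SUP_upper[OF that, of ereal] assms by (simp add: mu_max_def)
  then show "{b<..} \<inter> measure_support M = {}" by force
qed simp

lemma measure_below_finite_mu_min:
  assumes "mu_min M = ereal a"
  shows "measure M {..<a} = 0"
proof (rule measure_eq_0_outside_support)
  have "a \<le> s" if "s \<in> measure_support M" for s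
    using INF_lower[OF that, of ereal] assms by (simp add: mu_min_def)
  then show "{..<a} \<inter> measure_support M = {}" by force
qed simp

lemma tail_antimono: "x \<le> y \<Longrightarrow> measure M {y<..} \<le> measure M {x<..}"
  by (intro finite_measure_mono) auto

lemma tail_measurable[measurable]: "(\<lambda>x. measure M {x<..}) \<in> borel_measurable borel"
  unfolding tail_eq_cdf
  by (intro borel_measurable_diff borel_measurable_const borel_measurable_mono)
     (auto simp: mono_def cdf_nondecreasing)

lemma tail_tendsto_0: "((\<lambda>x. measure M {x<..}) \<longlongrightarrow> 0) at_top"
  unfolding tail_eq_cdf using tendsto_diff[OF tendsto_const cdf_lim_at_top_prob, of 1] by simp

section \<open>The density of a distribution with differentiable tail\<close>

text \<open>
  Both measures have the same mass on every \<open>{c<..}\<close>. For \<open>c > a\<close> this is the fundamental theorem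
  of calculus. The point \<open>c = a\<close>, where the tail may fail to be differentiable, is reached by letting
  \<open>c\<close> decrease to \<open>a\<close>: the tail is continuous from the right. Below \<open>a\<close> there is no mass.
\<close>

lemma density_from_tail_derivative:
  assumes S: "\<And>x. a < x \<Longrightarrow> ((\<lambda>x. measure M {x<..}) has_real_derivative - f x) (at x)"
    and f[measurable]: "f \<in> borel_measurable borel"
    and f_nonneg: "\<And>x. a < x \<Longrightarrow> 0 \<le> f x"
    and f_zero: "\<And>x. x \<le> a \<Longrightarrow> f x = 0"
    and Sa: "measure M {a<..} = 1"
  shows "M = density lborel (\<lambda>x. ennreal (f x))"
proof (rule measure_eqI_lessThan)
  let ?N = "density lborel (\<lambda>x. ennreal (f x))"
  let ?S = "\<lambda>x. measure M {x<..}"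
  fix c
  have above: "emeasure ?N {x<..} = ennreal (?S x)" if "a < x" for x
  proof -
    have "emeasure ?N {x<..} = (\<integral>\<^sup>+y. ennreal (f y) * indicator {x<..} y \<partial>lborel)"
      by (simp add: emeasure_density)
    also have "\<dots> = (\<integral>\<^sup>+y. ennreal (f y) * indicator {x..} y \<partial>lborel)"
      using AE_lborel_singleton[of x]
      by (intro nn_integral_cong_AE) (auto elim!: eventually_mono split: split_indicator)
    also have "\<dots> = ennreal (0 - (- ?S x))"
    proof (rule nn_integral_FTC_atLeast)
      show "((\<lambda>x. - ?S x) has_real_derivative f y) (at y)" if "x \<le> y" for y
        using DERIV_minus[OF S[of y]] \<open>a < x\<close> that by simp
      show "((\<lambda>x. - ?S x) \<longlongrightarrow> 0) at_top"
        using tendsto_minus[OF tail_tendsto_0] by simp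
    qed (use f_nonneg that in auto)
    finally show ?thesis by simp
  qed
  have at_a: "emeasure ?N {a<..} = 1"
  proof (rule LIMSEQ_unique)
    let ?c = "\<lambda>n. a + inverse (real (Suc n))"
    have "(\<lambda>n. emeasure ?N {?c n<..}) \<longlonglongrightarrow> emeasure ?N (\<Union>n. {?c n<..})"
      by (intro Lim_emeasure_incseq)
         (auto simp: incseq_def intro: le_less_trans[rotated] le_imp_inverse_le)
    also have "(\<Union>n. {?c n<..}) = {a<..}"
    proof safe
      fix x assume "a < x"
      then obtain n where "inverse (real (Suc n)) < x - a"
        using reals_Archimedean[of "x - a"] by auto
      then have "?c n < x" by linarith
      then show "x \<in> (\<Union>n. {?c n<..})" by blast
    next
      fix x n assume "?c n < x"
      then show "a < x"
        by (smt (verit) inverse_positive_iff_positive of_nat_0_less_iff zero_less_Suc)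
    qed
    finally show "(\<lambda>n. emeasure ?N {?c n<..}) \<longlonglongrightarrow> emeasure ?N {a<..}" .
    have "((\<lambda>x. ?S x) \<longlongrightarrow> ?S a) (at_right a)"
      using cdf_is_right_cont[of a] unfolding tail_eq_cdf continuous_within
      by (intro tendsto_intros)
    moreover have "filterlim ?c (at_right a) sequentially"
      using LIMSEQ_inverse_real_of_nat_add[of a]
      by (auto simp: filterlim_at intro!: always_eventually)
    ultimately have "(\<lambda>n. ?S (?c n)) \<longlonglongrightarrow> ?S a"
      by (rule filterlim_compose)
    then have "(\<lambda>n. ennreal (?S (?c n))) \<longlonglongrightarrow> ennreal 1"
      unfolding Sa by (rule tendsto_ennrealI)
    then show "(\<lambda>n. emeasure ?N {?c n<..}) \<longlonglongrightarrow> 1"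
      by (subst above) auto
  qed
  show "emeasure M {c<..} = emeasure ?N {c<..}"
  proof (cases "a < c")
    case True
    then show ?thesis using above by (simp add: emeasure_eq_measure)
  next
    case False
    have "emeasure ?N {c<..} = emeasure ?N {a<..}"
      using False f_zero
      by (auto simp: emeasure_density not_less intro!: nn_integral_cong split: split_indicator)
    moreover have "?S c = 1"
      using False tail_antimono[of c a] Sa prob_le_1[of "{c<..}"] by simp
    ultimately show ?thesis using at_a by (simp add: emeasure_eq_measure)
  qed
qed (auto simp: emeasure_eq_measure)

section \<open>Tails of the convolution square\<close>

text \<open>
  The event is the disjoint union of three sets: both coordinates are above \<open>m\<close>, the first
  is not, or only the second is not. Both of the last two contribute the integral on the right:
  they are not exact mirror images, since \<open>x = y = m\<close> belongs to the first of them only, but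
  this point has no mass.
\<close>

lemma emeasure_convolution_tail:
  assumes no_atoms: "\<And>x. measure M {x} = 0"
  shows "emeasure (M \<star> M) {2 * m..} =
    ennreal ((measure M {m<..})\<^sup>2)
      + 2 * (\<integral>\<^sup>+x. ennreal (measure M {2 * m - x<..}) * indicator {..m} x \<partial>M)"
proof -
  let ?S = "\<lambda>x. measure M {x<..}"
  interpret P: pair_sigma_finite M M ..
  define A where "A = {m<..} \<times> {m<..}"
  define B where "B = {(x, y). x \<le> m \<and> 2 * m \<le> x + y}"
  define C where "C = {(x, y). m < x \<and> y \<le> m \<and> 2 * m \<le> x + y}"
  have BC: "B = {p \<in> space (M \<Otimes>\<^sub>M M). fst p \<le> m \<and> 2 * m \<le> fst p + snd p}"
    "C = {p \<in> space (M \<Otimes>\<^sub>M M). m < fst p \<and> snd p \<le> m \<and> 2 * m \<le> fst p + snd p}"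
    by (auto simp: B_def C_def space_pair_measure borel_UNIV)
  have meas: "A \<in> sets (M \<Otimes>\<^sub>M M)" "B \<in> sets (M \<Otimes>\<^sub>M M)" "C \<in> sets (M \<Otimes>\<^sub>M M)"
    unfolding A_def BC by measurable
  have closed_tail: "measure M {x..} = ?S x" for x
  proof -
    have "measure M {x..} = measure M ({x} \<union> {x<..})"
      by (rule arg_cong[where f="measure M"]) auto
    also have "\<dots> = measure M {x} + ?S x"
      by (intro finite_measure_Union) auto
    finally show ?thesis using no_atoms by simp
  qed
  have "emeasure (M \<star> M) {2 * m..} = emeasure (M \<Otimes>\<^sub>M M) (A \<union> B \<union> C)"
    unfolding convolution_def
    by (subst emeasure_distr)
       (auto simp: space_pair_measure borel_UNIV A_def B_def C_def
         intro!: arg_cong[where f="emeasure (M \<Otimes>\<^sub>M M)"])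
  also have "\<dots> = emeasure (M \<Otimes>\<^sub>M M) A + emeasure (M \<Otimes>\<^sub>M M) B + emeasure (M \<Otimes>\<^sub>M M) C"
  proof -
    have "A \<inter> B = {}" "(A \<union> B) \<inter> C = {}"
      by (auto simp: A_def B_def C_def)
    then show ?thesis using meas by (simp add: plus_emeasure)
  qed
  also have "emeasure (M \<Otimes>\<^sub>M M) A = ennreal ((?S m)\<^sup>2)"
    unfolding A_def
    by (subst emeasure_pair_measure_Times)
       (auto simp: emeasure_eq_measure ennreal_mult power2_eq_square)
  also have "emeasure (M \<Otimes>\<^sub>M M) B = (\<integral>\<^sup>+x. ennreal (?S (2 * m - x)) * indicator {..m} x \<partial>M)"
    unfolding emeasure_pair_measure_alt[OF meas(2)]
  proof (intro nn_integral_cong)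
    fix x
    have "Pair x -` B = (if x \<le> m then {2 * m - x..} else {})"
      by (auto simp: B_def)
    then show "emeasure M (Pair x -` B) = ennreal (?S (2 * m - x)) * indicator {..m} x"
      by (simp add: emeasure_eq_measure closed_tail)
  qed
  also have "emeasure (M \<Otimes>\<^sub>M M) C = (\<integral>\<^sup>+y. ennreal (?S (2 * m - y)) * indicator {..m} y \<partial>M)"
    unfolding P.emeasure_pair_measure_alt2[OF meas(3)]
  proof (intro nn_integral_cong)
    fix y
    have "(\<lambda>x. (x, y)) -` C =
        (if y = m then {2 * m - y<..} else if y < m then {2 * m - y..} else {})"
      by (auto simp: C_def)
    then show "emeasure M ((\<lambda>x. (x, y)) -` C) = ennreal (?S (2 * m - y)) * indicator {..m} y"
      by (simp add: emeasure_eq_measure closed_tail)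
  qed
  finally show ?thesis by (simp only: mult_2[of "_ :: ennreal"] add.assoc)
qed

section \<open>Monotonicity for supports with a finite minimum and no maximum\<close>

text \<open>
  The density turns the integral in \<open>emeasure_convolution_tail\<close> into \<open>(S m)\<^sup>2\<close> times
  an integral \<open>K m\<close> over \<open>t\<close>, so that \<open>rho1\<close> is \<open>1 / (1 + 2 K)\<close>. The integrand of \<open>K\<close> is
  nondecreasing in \<open>m\<close> for every \<open>t\<close>, and between \<open>m - a\<close> and \<open>n - a\<close> it passes from zero to positive
  when \<open>m\<close> is increased to \<open>n\<close>.
\<close>

lemma rho1_strict_antimono_on_half_line:
  assumes g: "convex_with_concave_slope {a<..} g g1 g2"
    and g1_pos: "\<And>x. a < x \<Longrightarrow> 0 < g1 x"
    and tail: "\<And>x. a < x \<Longrightarrow> measure M {x<..} = exp (- g x)"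
    and tail_a: "measure M {a<..} = 1"
  shows "strict_antimono_on {a..} (rho1 M)"
proof -
  interpret g: convex_with_concave_slope "{a<..}" g g1 g2 by fact
  let ?S = "\<lambda>x. measure M {x<..}"
  \<comment> \<open>The hazard rate: density divided by tail. Its extension by 0 also cuts off the
    integrals over \<open>t\<close> below at \<open>t = m - a\<close>.\<close>
  define r where "r x = (if a < x then g1 x else 0)" for x
  have r_nonneg: "0 \<le> r x" for x using g1_pos[of x] by (simp add: r_def less_imp_le)
  have r_mono: "r x \<le> r y" if "x \<le> y" for x y
    using g.slope_mono[of x y] that g1_pos[of y] by (auto simp: r_def less_imp_le)
  have r_meas[measurable]: "r \<in> borel_measurable borel"
    by (intro borel_measurable_mono) (simp add: mono_def r_mono)
  have S_pos: "0 < ?S x" if "a \<le> x" for x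
    using that tail[of x] tail_a by (cases "x = a") auto
  have dens: "M = density lborel (\<lambda>x. ennreal (r x * ?S x))"
  proof (rule density_from_tail_derivative[of a])
    fix x assume x: "a < x"
    have "((\<lambda>x. exp (- g x)) has_real_derivative - (r x * ?S x)) (at x)"
      using g.g_deriv[of x] x by (auto intro!: derivative_eq_intros simp: r_def tail)
    moreover have "\<forall>\<^sub>F y in nhds x. ?S y = exp (- g y)"
      using eventually_nhds_in_open[of "{a<..}" x] x by (auto elim!: eventually_mono simp: tail)
    ultimately show "(?S has_real_derivative - (r x * ?S x)) (at x)"
      by (subst DERIV_cong_ev[OF refl _ refl]) auto
    show "0 \<le> r x * ?S x" using r_nonneg by simp
  next
    fix x assume "x \<le> a"
    then show "r x * ?S x = 0" by (simp add: r_def)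
  qed (simp_all add: tail_a)
  have no_atoms: "measure M {x} = 0" for x
  proof -
    have "emeasure M {x} = (\<integral>\<^sup>+y. ennreal (r y * ?S y) * indicator {x} y \<partial>lborel)"
      by (subst dens) (simp add: emeasure_density)
    also have "\<dots> = 0"
      by (subst nn_integral_indicator_singleton) simp_all
    finally show ?thesis by (simp add: measure_def)
  qed
  define k where
    "k m t = indicator {0..} t * (?S (m + t) * ?S (m - t) / (?S m)\<^sup>2 * r (m - t))" for m t
  define K where "K m = (\<integral>\<^sup>+t. ennreal (k m t) \<partial>lborel)" for m
  have k_meas[measurable]: "k m \<in> borel_measurable borel" for m
    unfolding k_def by measurable
  have k_nonneg: "0 \<le> k m t" for m t
    using r_nonneg by (simp add: k_def)
  have k_zero: "k m t = 0" if "t < 0 \<or> m - a \<le> t" for m t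
    using that by (auto simp: k_def r_def)
  have k_eq: "k m t = exp (- (g (m + t) + g (m - t) - 2 * g m)) * g1 (m - t)"
    if "0 \<le> t" "t < m - a" for m t
  proof -
    have "exp (- (g (m + t) + g (m - t) - 2 * g m)) =
        exp ((- g (m + t) + - g (m - t)) - 2 * (- g m))"
      by (rule arg_cong[where f=exp]) simp
    also have "\<dots> = ?S (m + t) * ?S (m - t) / (?S m)\<^sup>2"
      unfolding exp_diff exp_add exp_double using that by (simp add: tail)
    finally show ?thesis using that by (simp add: k_def r_def)
  qed
  \<comment> \<open>Change of variables \<open>x = m - t\<close>, with the normalising factor \<open>(S m)\<^sup>2\<close> taken out.\<close>
  have integral_eq: "(\<integral>\<^sup>+x. ennreal (?S (2 * m - x)) * indicator {..m} x \<partial>M)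
      = ennreal ((?S m)\<^sup>2) * K m" if "a \<le> m" for m
  proof -
    have "(\<integral>\<^sup>+x. ennreal (?S (2 * m - x)) * indicator {..m} x \<partial>M)
        = (\<integral>\<^sup>+x. ennreal (r x * ?S x) * (ennreal (?S (2 * m - x)) * indicator {..m} x) \<partial>lborel)"
      by (subst dens) (subst nn_integral_density; simp)
    also have "\<dots> = (\<integral>\<^sup>+t. ennreal (r (m - t) * ?S (m - t)) *
        (ennreal (?S (2 * m - (m - t))) * indicator {..m} (m - t)) \<partial>lborel)"
      by (subst nn_integral_real_affine[where c="-1" and t=m]) simp_all
    also have "\<dots> = (\<integral>\<^sup>+t. ennreal ((?S m)\<^sup>2) * ennreal (k m t) \<partial>lborel)"
    proof (intro nn_integral_cong)
      fix t
      have "r (m - t) * ?S (m - t) * ?S (m + t) = (?S m)\<^sup>2 * k m t" if "0 \<le> t"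
        using that S_pos[OF \<open>a \<le> m\<close>] by (simp add: k_def)
      moreover have "2 * m - (m - t) = m + t" by simp
      ultimately show "ennreal (r (m - t) * ?S (m - t)) *
          (ennreal (?S (2 * m - (m - t))) * indicator {..m} (m - t))
          = ennreal ((?S m)\<^sup>2) * ennreal (k m t)"
        using k_zero[of t m] r_nonneg k_nonneg
        by (auto split: split_indicator simp flip: ennreal_mult)
    qed
    also have "\<dots> = ennreal ((?S m)\<^sup>2) * K m"
      unfolding K_def by (subst nn_integral_cmult) simp_all
    finally show ?thesis .
  qed
  have conv_eq: "emeasure (M \<star> M) {2 * m..} = ennreal ((?S m)\<^sup>2) * (1 + 2 * K m)"
    if "a \<le> m" for m
    unfolding emeasure_convolution_tail[OF no_atoms] integral_eq[OF that]
    by (simp add: distrib_left mult.left_commute)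
  interpret conv: finite_measure "M \<star> M"
    by (rule convolution_finite) (auto intro: finite_measure_axioms)
  \<comment> \<open>Finiteness comes for free: \<open>K m\<close> is controlled by a probability. It is needed to
    compare integrals strictly and to pass to real numbers.\<close>
  have K_finite: "K m \<noteq> \<infinity>" if "a \<le> m" for m
    using conv_eq[OF that] conv.emeasure_finite[of "{2 * m..}"] S_pos[OF that]
    by (auto simp: ennreal_mult_top)
  have rho_eq: "rho1 M m = 1 / (1 + 2 * enn2real (K m))" if "a \<le> m" for m
  proof -
    have "measure (M \<star> M) {2 * m..} = (?S m)\<^sup>2 * (1 + 2 * enn2real (K m))"
      using conv_eq[OF that] K_finite[OF that]
      by (simp add: measure_def enn2real_mult enn2real_plus ennreal_mult_less_top less_top)
    then show ?thesis using S_pos[OF that] by (simp add: rho1_def)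
  qed
  have K_less: "K m < K n" if "a \<le> m" "m < n" for m n
    unfolding K_def
  proof (rule nn_integral_less)
    show "(\<integral>\<^sup>+t. ennreal (k m t) \<partial>lborel) \<noteq> \<infinity>"
      using K_finite[OF that(1)] by (simp add: K_def)
    have "k m t \<le> k n t" for t
    proof (cases "0 \<le> t \<and> t < m - a")
      case True
      have "exp (- (g (m + t) + g (m - t) - 2 * g m)) * g1 (m - t)
          \<le> exp (- (g (n + t) + g (n - t) - 2 * g n)) * g1 (n - t)"
      proof (rule mult_mono)
        show "exp (- (g (m + t) + g (m - t) - 2 * g m)) \<le> exp (- (g (n + t) + g (n - t) - 2 * g n))"
          using g.second_difference_antimono[of m t n] True that by simp
        show "g1 (m - t) \<le> g1 (n - t)"
          using True that by (intro g.slope_mono) auto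
        show "0 \<le> g1 (m - t)" using True g1_pos[of "m - t"] by simp
      qed simp
      then show ?thesis using True that by (simp add: k_eq)
    next
      case False
      then show ?thesis using k_zero[of t m] k_nonneg[of n t] by auto
    qed
    then show "AE t in lborel. ennreal (k m t) \<le> ennreal (k n t)"
      by (simp add: ennreal_leI)
    show "\<not> (AE t in lborel. ennreal (k n t) \<le> ennreal (k m t))"
    proof
      assume "AE t in lborel. ennreal (k n t) \<le> ennreal (k m t)"
      moreover have "\<not> ennreal (k n t) \<le> ennreal (k m t)" if t: "t \<in> {m - a<..<n - a}" for t
      proof -
        have "0 < k n t"
          using t \<open>a \<le> m\<close> g1_pos[of "n - t"] by (simp add: k_eq)
        moreover have "k m t = 0" using t by (intro k_zero) auto
        ultimately show ?thesis by simp
      qed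
      ultimately have "AE t in lborel. t \<notin> {m - a<..<n - a}"
        by (auto elim!: eventually_mono)
      then have "emeasure lborel {m - a<..<n - a} = 0"
        by (subst (asm) AE_iff_null_sets[symmetric]) auto
      then show False using that by simp
    qed
  qed simp_all
  show ?thesis
  proof (rule monotone_onI)
    fix m n assume mn: "m \<in> {a..}" "n \<in> {a..}" "m < n"
    have "enn2real (K m) < enn2real (K n)"
      using K_less[of m n] K_finite[of n] mn by (simp add: enn2real_less_iff less_top)
    then show "rho1 M n < rho1 M m"
      using mn by (simp add: rho_eq frac_less2 add_pos_nonneg)
  qed
qed

end

section \<open>The interval between the endpoints of the support\<close>

lemma open_open_range: "open (open_range M)"
proof -
  have "open_range M = ereal -` {mu_min M<..<mu_max M}"
    by (auto simp: open_range_def)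
  then show ?thesis using open_vimage[of "{mu_min M<..<mu_max M}" ereal] by (simp add: continuous_on_ereal)
qed

lemma is_interval_open_range: "is_interval (open_range M)"
  unfolding is_interval_1 open_range_def
  by (auto intro: less_le_trans[of "mu_min M" "ereal _" "ereal _"]
      le_less_trans[of "ereal _" "ereal _" "mu_max M"])

lemma (in real_distribution) convex_with_concave_slope_neg_log_tail:
  assumes diff: "thrice_differentiable_on (neg_log_tail M) (open_range M)"
    and second: "\<And>x. x \<in> open_range M \<Longrightarrow> (deriv ^^ 2) (neg_log_tail M) x \<ge> 0"
    and third: "\<And>x. x \<in> open_range M \<Longrightarrow> (deriv ^^ 3) (neg_log_tail M) x \<le> 0"
  shows "convex_with_concave_slope (open_range M) (neg_log_tail M)
    (deriv (neg_log_tail M)) ((deriv ^^ 2) (neg_log_tail M))"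
proof
  have deriv_k: "((deriv ^^ k) (neg_log_tail M) has_real_derivative
      (deriv ^^ Suc k) (neg_log_tail M) x) (at x)"
    if "k < 3" "x \<in> open_range M" for k x
    using diff that by (simp add: thrice_differentiable_on_def DERIV_deriv_iff_real_differentiable)
  show "(neg_log_tail M has_real_derivative deriv (neg_log_tail M) x) (at x)"
    if "x \<in> open_range M" for x
    using deriv_k[of 0 x] that by simp
  show "(deriv (neg_log_tail M) has_real_derivative (deriv ^^ 2) (neg_log_tail M) x) (at x)"
    if "x \<in> open_range M" for x
    using deriv_k[of 1 x] that by (simp add: numeral_2_eq_2)
  show "(deriv ^^ 2) (neg_log_tail M) y \<le> (deriv ^^ 2) (neg_log_tail M) x"
    if "x \<in> open_range M" "y \<in> open_range M" "x \<le> y" for x y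
  proof (rule DERIV_nonpos_imp_nonincreasing[OF that(3)])
    fix z assume "x \<le> z" "z \<le> y"
    then have "z \<in> open_range M"
      using mem_is_interval_1_I[OF is_interval_open_range that(1,2)] by blast
    then show "\<exists>d. ((deriv ^^ 2) (neg_log_tail M) has_real_derivative d) (at z) \<and> d \<le> 0"
      using deriv_k[of 2 z] third[of z] by (auto simp: numeral_3_eq_3)
  qed
qed (use second in \<open>auto intro: open_open_range is_interval_open_range\<close>)

theorem proposition1p4:
  fixes M :: "real measure"
  assumes "real_distribution M"
    and "no_endpoint_atoms M"
    and "thrice_differentiable_on (neg_log_tail M) (open_range M)"
    and "\<And>x. x \<in> open_range M \<Longrightarrow> (deriv ^^ 2) (neg_log_tail M) x \<ge> 0"
    and "\<And>x. x \<in> open_range M \<Longrightarrow> (deriv ^^ 3) (neg_log_tail M) x \<le> 0"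
  shows "strict_antimono_on (right_open_range M) (rho1 M)"
proof (cases "right_open_range M = {}")
  case True
  then show ?thesis by (simp add: monotone_on_def)
next
  case False
  interpret real_distribution M by fact
  interpret g: convex_with_concave_slope "open_range M" "neg_log_tail M"
    "deriv (neg_log_tail M)" "(deriv ^^ 2) (neg_log_tail M)"
    by (rule convex_with_concave_slope_neg_log_tail) (use assms in auto)
  let ?S = "\<lambda>x. measure M {x<..}" and ?g = "neg_log_tail M" and ?I = "open_range M"
  have tail: "?S x = exp (- ?g x)" if "ereal x < mu_max M" for x
    using tail_pos[OF that] by (simp add: neg_log_tail_def)
  have g_mono: "mono_on ?I ?g"
    using tail_antimono tail_pos by (auto simp: mono_on_def neg_log_tail_def open_range_def)
  have slope_nonneg: "0 \<le> deriv ?g x" if "x \<in> ?I" for x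
    using mono_on_imp_deriv_nonneg[OF g_mono g.g_deriv[OF that]] that open_open_range
    by (simp add: interior_open)
  have g_nonneg: "0 \<le> ?g x" if "x \<in> ?I" for x
    using tail_pos[of x] that by (simp add: neg_log_tail_def open_range_def)
  have min_less_max: "mu_min M < mu_max M"
    using False by (auto simp: right_open_range_def)
  then obtain c where c: "c \<in> ?I"
    using ereal_dense2[of "mu_min M" "mu_max M"] by (auto simp: open_range_def)
  \<comment> \<open>At a finite \<open>mu_max\<close> the tail tends to 0, as there is no atom, but \<open>g\<close> stays bounded.\<close>
  have max_infinite: "mu_max M = \<infinity>"
  proof (cases "mu_max M")
    case (real b)
    have cb: "c < b" using c real by (simp add: open_range_def)
    define L where "L = ?g c + (b - c) * (deriv ?g c + (b - c) * (deriv ^^ 2) ?g c)"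
    have "exp (- L) \<le> ?S x" if x: "c < x" "x < b" for x
    proof -
      have xI: "x \<in> ?I"
        using c x real less_trans[of "mu_min M" "ereal c" "ereal x"] by (simp add: open_range_def)
      have "?g x \<le> ?g c + (x - c) * (deriv ?g c + (x - c) * (deriv ^^ 2) ?g c)"
        using g.quadratic_upper_bound[OF c xI] x by simp
      also have "\<dots> \<le> L"
        unfolding L_def using x slope_nonneg[OF c] g.g2_nonneg[OF c]
        by (intro add_left_mono mult_mono add_mono mult_right_mono add_nonneg_nonneg) auto
      finally show ?thesis using tail[of x] x real by simp
    qed
    then have "\<forall>\<^sub>F x in at_left b. exp (- L) \<le> ?S x"
      using cb by (auto simp: eventually_at_left[OF cb])
    moreover have "(?S \<longlongrightarrow> 1 - measure M {..<b}) (at_left b)"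
      unfolding tail_eq_cdf by (intro tendsto_intros cdf_at_left)
    moreover have "1 - measure M {..<b} = 0"
    proof -
      have "measure M {..b} = measure M ({..<b} \<union> {b})"
        by (rule arg_cong[where f="measure M"]) auto
      also have "\<dots> = measure M {..<b} + measure M {b}"
        by (intro finite_measure_Union) auto
      finally show ?thesis
        using tail_at_finite_mu_max[OF real] tail_eq_cdf[of b] assms(2) real
        by (simp add: cdf_def no_endpoint_atoms_def)
    qed
    ultimately have "exp (- L) \<le> 0"
      by (intro tendsto_lowerbound[of ?S 0 "at_left b"]) auto
    then show ?thesis by simp
  qed (use min_less_max in auto)
  \<comment> \<open>A constant tail cannot be positive, because it tends to 0 at infinity.\<close>
  have nonconstant: "\<exists>x\<in>?I. \<exists>y\<in>?I. ?g x \<noteq> ?g y"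
  proof (rule ccontr)
    assume "\<not> ?thesis"
    then have const: "?g x = ?g c" if "x \<in> ?I" for x
      using c that by blast
    have tail_const: "?S x = ?S c" if "c \<le> x" for x
    proof -
      have "x \<in> ?I"
        using c that max_infinite less_le_trans[of "mu_min M" "ereal c" "ereal x"]
        by (simp add: open_range_def)
      then show ?thesis using const[of x] tail[of x] tail[of c] max_infinite by simp
    qed
    have "\<forall>\<^sub>F x in at_top. ?S x = ?S c"
      by (rule eventually_mono[OF eventually_ge_at_top tail_const])
    then have "(?S \<longlongrightarrow> ?S c) at_top"
      by (rule tendsto_eventually)
    then have "?S c = 0"
      using tendsto_unique[OF _ _ tail_tendsto_0] by simp
    then show False using tail_pos[of c] max_infinite by simp
  qed
  have slope_pos: "0 < deriv ?g x" if "x \<in> ?I" for x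
  proof (rule ccontr)
    assume "\<not> 0 < deriv ?g x"
    then have "deriv ?g x = 0" using slope_nonneg[OF that] by simp
    from g.constant_if_slope_vanishes[OF slope_nonneg that this] show False
      using nonconstant by blast
  qed
  obtain a where a: "mu_min M = ereal a"
  proof (cases "mu_min M")
    case MInf
    then have UNIV: "?I = UNIV" using max_infinite by (auto simp: open_range_def)
    have "?g x = ?g y" for x y
      by (rule g.constant_if_nonneg_on_whole_line[OF UNIV])
         (use slope_nonneg g_nonneg UNIV in auto)
    then show ?thesis using nonconstant by blast
  qed (use that min_less_max in auto)
  have I_eq: "?I = {a<..}" and right_eq: "right_open_range M = {a..}"
    using a max_infinite by (auto simp: open_range_def right_open_range_def)
  \<comment> \<open>The tail at \<open>a\<close> is 1 because there is neither mass below \<open>a\<close> nor an atom at \<open>a\<close>.\<close>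
  have "measure M {..a} = measure M ({..<a} \<union> {a})"
    by (rule arg_cong[where f="measure M"]) auto
  also have "\<dots> = measure M {..<a} + measure M {a}"
    by (intro finite_measure_Union) auto
  finally have "?S a = 1"
    using measure_below_finite_mu_min[OF a] assms(2) a tail_eq_cdf[of a]
    by (simp add: cdf_def no_endpoint_atoms_def)
  then show ?thesis
    unfolding right_eq
    using g.convex_with_concave_slope_axioms slope_pos tail max_infinite
    by (intro rho1_strict_antimono_on_half_line) (auto simp: I_eq)
qed

end
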